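(* Let $\Delta',\Delta''$ be two orientations of a tree $\Gamma$ that differ by the direction of $k$ edges, and let $\Delta'=\Delta_0,\Delta_1,\dots,\Delta_k=\Delta''$ be a chain of orientations in which every two adjacent ones differ by the direction of one edge. Let $P_i,S_i$ ($i=1,\dots,k$) be elements of the Weyl group, given as products of simple reflections, such that $${\bf C}_{\Delta_{i-1}}=P_iS_i,\qquad {\bf C}_{\Delta_i}=S_iP_i\qquad(i=1,\dots,k),$$ and such that, for each simple reflection and each $i$, this reflection does not occur in the decomposition of at least one of $P_i$, $S_i^{-1}$. 1) One has $T^{-1}{\bf C}_{\Delta'}T={\bf C}_{\Delta''}$ for each of the following $k+1$ elements $T=T_j$, $j=1,\dots,k+1$: $$T_j=P_1P_2\cdots P_{k-j+1}\,S_{k-j+2}^{-1}\cdots S_{k-1}^{-1}S_k^{-1},$$ i.e. $T_1=P_1P_2\cdots P_k$, $T_2=P_1\cdots P_{k-1}S_k^{-1}$, $\dots$, $T_k=P_1S_2^{-1}\cdots S_k^{-1}$, $T_{k+1}=S_1^{-1}S_2^{-1}\cdots S_k^{-1}$. In addition, for each simple reflection $\sigma_\alpha$ there exists a $T_j$ which has a decomposition into simple reflections not containing $\sigma_\alpha$. 2) For all $p,q\in\{1,\dots,k+1\}$, $$T_pT_q^{-1}={\bf C}_{\Delta'}^{\,q-p}.$$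
   Context: $\Gamma$ is a (valued) tree with Cartan matrix $K$; $\sigma_v(z)=z-(Kz)_v\alpha_v$ are the simple reflections, generating the Weyl group. For an orientation $\Delta$ a vertex is sink-admissible if all arrows at it end in it, and $\sigma_v$ acts on orientations by reversing all arrows at $v$. ${\bf C}_\Delta=\sigma_{v_n}\cdots\sigma_{v_1}$, where $v_1,\dots,v_n$ is an enumeration of all vertices such that $v_1$ is sink-admissible in $\Delta$, $v_2$ is sink-admissible in $\sigma_{v_1}(\Delta)$, and so on; ${\bf C}_\Delta$ depends only on $\Delta$. Elements $P_i,S_i$ as in the hypothesis always exist: one may take the Coxeter transformations of the two components of $\Gamma$ minus the reversed edge. *)

theory Defs
  imports "HOL-Analysis.Analysis" "HOL-Algebra.Generated_Groups" "HOL-Algebra.Bij"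
begin

section \<open>Valued trees\<close>

text \<open>
  A valued graph on the finite vertex type \<open>'v\<close> is given by its valuation: \<open>v\<close> and \<open>w\<close> are
  joined by an edge iff \<open>d v w > 0\<close>, and the edge then carries the pair \<open>(d v w, d w v)\<close>.
  An ordinary tree is the case where all these numbers are 1. The symmetrizability required of
  valued graphs in general holds automatically on a tree and is therefore not listed.
\<close>

definition adj :: "('v \<Rightarrow> 'v \<Rightarrow> nat) \<Rightarrow> 'v \<Rightarrow> 'v \<Rightarrow> bool" where
  "adj d v w \<longleftrightarrow> 0 < d v w"

text \<open>
  The notion \<open>tree\<close> of the AFP entry \<open>Graph_Theory\<close> excludes only directed cycles (so an acyclically
  oriented triangle is a tree there, and a symmetric graph with an edge is not), hence
  cycles are excluded explicitly.
\<close>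

definition valued_tree :: "('v::finite \<Rightarrow> 'v \<Rightarrow> nat) \<Rightarrow> bool" where
  "valued_tree d \<longleftrightarrow>
     (\<forall>v. d v v = 0) \<and>
     (\<forall>v w. 0 < d v w \<longleftrightarrow> 0 < d w v) \<and>
     (\<forall>v w. (adj d)\<^sup>*\<^sup>* v w) \<and>
     \<not> (\<exists>c. 3 \<le> length c \<and> distinct c \<and> successively (adj d) c \<and> adj d (last c) (hd c))"

definition cartan :: "('v::finite \<Rightarrow> 'v \<Rightarrow> nat) \<Rightarrow> 'a::comm_ring_1 ^ 'v ^ 'v" where
  "cartan d = (\<chi> v w. if v = w then 2 else - of_nat (d v w))"


section \<open>The Weyl group\<close>

text \<open>
  The group acts on \<open>'a ^ 'v\<close>; the scalars are left open, so that with the class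
  \<open>ring_char_0\<close> the root lattice and the rational, real and complex versions are all covered.
\<close>

definition simple_refl ::
    "('v::finite \<Rightarrow> 'v \<Rightarrow> nat) \<Rightarrow> 'v \<Rightarrow> 'a::comm_ring_1 ^ 'v \<Rightarrow> 'a ^ 'v" where
  "simple_refl d v z = z - ((cartan d *v z) $ v) *s axis v 1"

definition weyl_group ::
    "('v::finite \<Rightarrow> 'v \<Rightarrow> nat) \<Rightarrow> ('a::comm_ring_1 ^ 'v \<Rightarrow> 'a ^ 'v) monoid" where
  "weyl_group d = subgroup_generated (BijGroup UNIV) (range (simple_refl d))"

definition list_mult :: "('g, 'm) monoid_scheme \<Rightarrow> 'g list \<Rightarrow> 'g" where
  "list_mult G xs = foldr (mult G) xs (one G)"

text \<open>
  A decomposition into simple reflections is recorded as the list of their vertices, read from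
  left to right. Distinct vertices have distinct reflections, since only \<open>simple_refl d v\<close>
  changes the coordinate \<open>v\<close>.
\<close>

definition refl_word ::
    "('v::finite \<Rightarrow> 'v \<Rightarrow> nat) \<Rightarrow> 'v list \<Rightarrow> 'a::comm_ring_1 ^ 'v \<Rightarrow> 'a ^ 'v" where
  "refl_word d vs = list_mult (weyl_group d) (map (simple_refl d) vs)"


section \<open>Orientations and Coxeter transformations\<close>

definition orientation :: "('v \<Rightarrow> 'v \<Rightarrow> nat) \<Rightarrow> ('v \<times> 'v) set \<Rightarrow> bool" where
  "orientation d D \<longleftrightarrow>
     (\<forall>(v, w) \<in> D. adj d v w) \<and>
     (\<forall>v w. adj d v w \<longrightarrow> ((v, w) \<in> D) \<noteq> ((w, v) \<in> D))"

definition reversed_edges :: "('v \<times> 'v) set \<Rightarrow> ('v \<times> 'v) set \<Rightarrow> 'v set set" where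
  "reversed_edges D D' = {{v, w} | v w. (v, w) \<in> D \<and> (w, v) \<in> D'}"

definition sink_admissible :: "('v \<times> 'v) set \<Rightarrow> 'v \<Rightarrow> bool" where
  "sink_admissible D v \<longleftrightarrow> (\<forall>(u, w) \<in> D. v \<in> {u, w} \<longrightarrow> w = v)"

definition reverse_at :: "'v \<Rightarrow> ('v \<times> 'v) set \<Rightarrow> ('v \<times> 'v) set" where
  "reverse_at v D = {(u, w) \<in> D. v \<notin> {u, w}} \<union> {(w, u) | u w. (u, w) \<in> D \<and> v \<in> {u, w}}"

fun sink_sequence :: "('v \<times> 'v) set \<Rightarrow> 'v list \<Rightarrow> bool" where
  "sink_sequence D [] \<longleftrightarrow> True"
| "sink_sequence D (v # vs) \<longleftrightarrow> sink_admissible D v \<and> sink_sequence (reverse_at v D) vs"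

definition sink_enumeration :: "('v \<times> 'v) set \<Rightarrow> 'v list \<Rightarrow> bool" where
  "sink_enumeration D vs \<longleftrightarrow> distinct vs \<and> set vs = UNIV \<and> sink_sequence D vs"

text \<open>
  The list is reversed because the reflection at the first vertex of the enumeration is applied
  first, i.e. is the rightmost factor. Existence and uniqueness are shown at the end of the theory.
\<close>

definition coxeter ::
    "('v::finite \<Rightarrow> 'v \<Rightarrow> nat) \<Rightarrow> ('v \<times> 'v) set \<Rightarrow> 'a::comm_ring_1 ^ 'v \<Rightarrow> 'a ^ 'v" where
  "coxeter d D = (THE C. \<exists>vs. sink_enumeration D vs \<and> C = refl_word d (rev vs))"

text \<open>
  \<open>P\<^sub>1 \<cdots> P\<^sub>m S\<^sub>m\<^sub>+\<^sub>1\<inverse> \<cdots> S\<^sub>k\<inverse>\<close> with \<open>m = k - j + 1\<close>, for \<open>1 \<le> j \<le> k + 1\<close>. The bound \<open>m + 1\<close> of the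
  half-open index ranges is written \<open>k + 2 - j\<close> because \<open>k - j\<close> would be truncated at \<open>j = k + 1\<close>.
\<close>

definition conjugator ::
    "('g, 'm) monoid_scheme \<Rightarrow> nat \<Rightarrow> (nat \<Rightarrow> 'g) \<Rightarrow> (nat \<Rightarrow> 'g) \<Rightarrow> nat \<Rightarrow> 'g" where
  "conjugator G k P S j =
     list_mult G (map P [1 ..< k + 2 - j] @ map (\<lambda>i. inv\<^bsub>G\<^esub> (S i)) [k + 2 - j ..< k + 1])"


section \<open>The Coxeter transformation is well defined\<close>

lemma cartan_nth: "(cartan d *v z) $ v = 2 * z $ v - (\<Sum>w\<in>UNIV - {v}. of_nat (d v w) * z $ w)"
proof -
  have "(cartan d *v z) $ v = (\<Sum>w\<in>UNIV. (if v = w then 2 else - of_nat (d v w)) * z $ w)"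
    by (simp add: cartan_def matrix_vector_mult_def)
  also have "\<dots> = 2 * z $ v + (\<Sum>w\<in>UNIV - {v}. (if v = w then 2 else - of_nat (d v w)) * z $ w)"
    by (subst sum.remove[of _ v]) auto
  also have "(\<Sum>w\<in>UNIV - {v}. (if v = w then 2 else - of_nat (d v w)) * z $ w)
      = - (\<Sum>w\<in>UNIV - {v}. of_nat (d v w) * z $ w)"
    unfolding sum_negf[symmetric] by (rule sum.cong) auto
  finally show ?thesis by simp
qed

lemma simple_refl_nth:
  "simple_refl d v z $ w =
     (if w = v then (\<Sum>x\<in>UNIV - {v}. of_nat (d v x) * z $ x) - z $ v else z $ w)"
  by (auto simp: simple_refl_def cartan_nth vector_scalar_mult_def axis_def)

lemma simple_refl_invol [simp]: "simple_refl d v (simple_refl d v z) = z"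
  by (auto simp: vec_eq_iff simple_refl_nth)

lemma simple_refl_commute:
  assumes "d v w = 0" "d w v = 0"
  shows "simple_refl d v (simple_refl d w z) = simple_refl d w (simple_refl d v z)"
proof -
  have A: "(\<Sum>x\<in>UNIV - {v}. of_nat (d v x) * simple_refl d w z $ x)
      = (\<Sum>x\<in>UNIV - {v}. of_nat (d v x) * z $ x)"
    by (rule sum.cong) (auto simp: simple_refl_nth assms)
  have B: "(\<Sum>x\<in>UNIV - {w}. of_nat (d w x) * simple_refl d v z $ x)
      = (\<Sum>x\<in>UNIV - {w}. of_nat (d w x) * z $ x)"
    by (rule sum.cong) (auto simp: simple_refl_nth assms)
  show ?thesis
    using A B by (auto simp: vec_eq_iff simple_refl_nth[of d v "simple_refl d w z"]
        simple_refl_nth[of d w "simple_refl d v z"])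
      (auto simp: simple_refl_nth)
qed

lemma simple_refl_Bij: "simple_refl d v \<in> Bij UNIV"
  by (auto simp: Bij_def intro!: bij_betw_byWitness[where f' = "simple_refl d v"])

lemma group_weyl_group: "group (weyl_group d)"
  unfolding weyl_group_def by (intro group.group_subgroup_generated group_BijGroup)

lemma simple_refl_weyl_group: "simple_refl d v \<in> carrier (weyl_group d)"
  unfolding weyl_group_def carrier_subgroup_generated
  by (rule generate.incl) (auto simp: BijGroup_def simple_refl_Bij)

lemma weyl_group_mult:
  assumes "f \<in> carrier (weyl_group d)" "g \<in> carrier (weyl_group d)"
  shows "f \<otimes>\<^bsub>weyl_group d\<^esub> g = f \<circ> g"
proof -
  have "carrier (weyl_group d) \<subseteq> carrier (BijGroup UNIV)"
    unfolding weyl_group_def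
    by (rule group.carrier_subgroup_generated_subset) (rule group_BijGroup)
  with assms have "f \<in> Bij UNIV" "g \<in> Bij UNIV" by (auto simp: BijGroup_def)
  then show ?thesis
    by (simp add: weyl_group_def subgroup_generated_def BijGroup_def compose_def comp_def
        restrict_UNIV)
qed

lemma refl_word_Nil: "refl_word d [] = id"
  by (auto simp: refl_word_def list_mult_def weyl_group_def subgroup_generated_def BijGroup_def)

lemma refl_word_weyl_group: "refl_word d vs \<in> carrier (weyl_group d)"
proof -
  interpret group "weyl_group d" by (rule group_weyl_group)
  show ?thesis
    by (induction vs) (auto simp: refl_word_def list_mult_def simple_refl_weyl_group)
qed

lemma refl_word_Cons: "refl_word d (v # vs) = simple_refl d v \<circ> refl_word d vs"
  using weyl_group_mult[OF simple_refl_weyl_group refl_word_weyl_group]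
  by (simp add: refl_word_def list_mult_def)

lemma refl_word_append: "refl_word d (us @ vs) = refl_word d us \<circ> refl_word d vs"
  by (induction us) (auto simp: refl_word_Nil refl_word_Cons)

text \<open>\<open>D\<close> after all vertices of \<open>A\<close> have been processed.\<close>

definition flip :: "('v \<times> 'v) set \<Rightarrow> 'v set \<Rightarrow> ('v \<times> 'v) set" where
  "flip D A = {(u, w). if (u \<in> A) = (w \<in> A) then (u, w) \<in> D else (w, u) \<in> D}"

lemma reverse_at_flip: "v \<notin> A \<Longrightarrow> irrefl D \<Longrightarrow> reverse_at v (flip D A) = flip D (insert v A)"
  unfolding reverse_at_def flip_def irrefl_def by (auto split: if_splits)

lemma all_Cons_split:
  "(\<forall>a v b. x # xs = a @ v # b \<longrightarrow> Q a v) \<longleftrightarrow>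
     Q [] x \<and> (\<forall>a v b. xs = a @ v # b \<longrightarrow> Q (x # a) v)"
  by (metis append_Cons append_Nil list.exhaust list.inject)

lemma sink_sequence_flip:
  assumes "irrefl D" "distinct vs" "set vs \<inter> A = {}"
  shows "sink_sequence (flip D A) vs \<longleftrightarrow>
    (\<forall>a v b. vs = a @ v # b \<longrightarrow> sink_admissible (flip D (A \<union> set a)) v)"
  using assms(2,3)
proof (induction vs arbitrary: A)
  case (Cons x vs)
  have "sink_sequence (flip D A) (x # vs) \<longleftrightarrow>
     sink_admissible (flip D A) x \<and> sink_sequence (flip D (insert x A)) vs"
    using Cons.prems assms(1) by (simp add: reverse_at_flip)
  also have "sink_sequence (flip D (insert x A)) vs \<longleftrightarrow>
     (\<forall>a v b. vs = a @ v # b \<longrightarrow> sink_admissible (flip D (insert x A \<union> set a)) v)"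
    using Cons.IH[of "insert x A"] Cons.prems by simp
  also have "sink_admissible (flip D A) x \<and> \<dots> \<longleftrightarrow>
     (\<forall>a v b. x # vs = a @ v # b \<longrightarrow> sink_admissible (flip D (A \<union> set a)) v)"
    unfolding all_Cons_split by simp
  finally show ?case .
qed simp

lemma orientationD:
  assumes "orientation d D" "(v, w) \<in> D"
  shows "adj d v w" "(w, v) \<notin> D"
  using assms unfolding orientation_def by blast+

lemma orientation_irrefl: "valued_tree d \<Longrightarrow> orientation d D \<Longrightarrow> irrefl D"
  using orientationD(2) by (fastforce simp: irrefl_def)

text \<open>
  An enumeration is sink-admissible iff every arrow's target precedes its source.
\<close>

lemma sink_enumeration_iff:
  assumes "irrefl D" "antisym D"
  shows "sink_enumeration D vs \<longleftrightarrow> distinct vs \<and> set vs = UNIV \<and>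
    (\<forall>a v b w. vs = a @ v # b \<longrightarrow> (v, w) \<in> D \<longrightarrow> w \<in> set a)"
proof (cases "distinct vs \<and> set vs = UNIV")
  case True
  have 0: "flip D {} = D" by (auto simp: flip_def)
  have "sink_sequence D vs \<longleftrightarrow>
      (\<forall>a v b. vs = a @ v # b \<longrightarrow> sink_admissible (flip D (set a)) v)"
    using sink_sequence_flip[of D vs "{}"] True assms(1) 0 by simp
  also have "\<dots> \<longleftrightarrow> (\<forall>a v b w. vs = a @ v # b \<longrightarrow> (v, w) \<in> D \<longrightarrow> w \<in> set a)" (is "?L \<longleftrightarrow> ?R")
  proof
    assume L: ?L
    show ?R
    proof (intro allI impI)
      fix a v b w assume *: "vs = a @ v # b" "(v, w) \<in> D"
      have "sink_admissible (flip D (set a)) v" using L * by blast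
      moreover have "v \<notin> set a" using True * by auto
      moreover have "w \<noteq> v" using * assms(1) by (auto simp: irrefl_def)
      ultimately have "(v, w) \<notin> flip D (set a)" by (auto simp: sink_admissible_def)
      then show "w \<in> set a"
        using * \<open>v \<notin> set a\<close> by (auto simp: flip_def split: if_splits)
    qed
  next
    assume R: ?R
    show ?L
    proof (intro allI impI)
      fix a v b assume *: "vs = a @ v # b"
      have v: "v \<notin> set a" using True * by auto
      have "(w, v) \<notin> D" if w: "w \<in> set a" for w
      proof
        assume D: "(w, v) \<in> D"
        obtain a1 a2 where a: "a = a1 @ w # a2" using w by (meson split_list)
        have "vs = a1 @ w # (a2 @ v # b)" using * a by simp
        then have "v \<in> set a1" using R D by blast
        then show False using v a by simp
      qed
      then show "sink_admissible (flip D (set a)) v"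
        using R * v by (auto simp: sink_admissible_def flip_def split: if_splits)
    qed
  qed
  finally show ?thesis using True by (simp add: sink_enumeration_def)
qed (auto simp: sink_enumeration_def)

lemma orientation_antisym: "valued_tree d \<Longrightarrow> orientation d D \<Longrightarrow> antisym D"
  using orientationD(2) by (fastforce simp: antisym_def)

lemma ex_sink:
  assumes d: "valued_tree d" and D: "orientation d D" and A: "A \<noteq> {}"
  shows "\<exists>v\<in>A. \<forall>w\<in>A. (v, w) \<notin> D"
proof (rule ccontr)
  assume "\<not> ?thesis"
  then have succ: "\<exists>w\<in>A. (v, w) \<in> D" if "v \<in> A" for v using that by blast
  define path where
    "path c \<longleftrightarrow> c \<noteq> [] \<and> distinct c \<and> set c \<subseteq> A \<and> successively (\<lambda>u w. (u, w) \<in> D) c" for c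
  obtain x where "x \<in> A" using A by blast
  then have "path [x]" by (simp add: path_def)
  moreover have "length c < Suc (CARD('a))" if "path c" for c
    using that by (metis path_def distinct_card card_mono finite subset_UNIV less_Suc_eq_le)
  ultimately obtain c where c: "path c" and max: "\<And>c'. path c' \<Longrightarrow> length c' \<le> length c"
    using ex_has_greatest_nat[of path "[x]" length "Suc CARD('a)"] by (metis less_imp_le)
  have "last c \<in> A" using c last_in_set[of c] unfolding path_def by auto
  then obtain w where w: "w \<in> A" "(last c, w) \<in> D"
    using succ by blast
  have "w \<in> set c"
  proof (rule ccontr)
    assume "w \<notin> set c"
    then have "path (c @ [w])" using c w by (auto simp: path_def successively_append_iff)
    then show False using max by fastforce
  qed
  then obtain a b where ab: "c = a @ w # b" by (meson split_list)
  let ?c = "w # b"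
  have lst: "last ?c = last c" using ab by simp
  have s: "successively (\<lambda>u w. (u, w) \<in> D) ?c"
    using c ab by (simp add: path_def successively_append_iff)
  have "distinct ?c" using c ab by (simp add: path_def)
  moreover have "successively (adj d) ?c"
    by (rule successively_mono[OF s]) (use D in \<open>auto simp: orientation_def\<close>)
  moreover have "adj d (last ?c) (hd ?c)" using w lst D by (auto simp: orientation_def)
  moreover have "3 \<le> length ?c"
  proof (rule ccontr)
    assume "\<not> ?thesis"
    then consider "b = []" | y where "b = [y]" by (cases b) (auto simp: Suc_le_eq)
    then show False
    proof cases
      case 1
      then show False using w lst orientation_irrefl[OF d D] by (simp add: irrefl_def)
    next
      case 2
      then have "(w, y) \<in> D" "(y, w) \<in> D" using s w lst by auto
      then show False
        using orientation_irrefl[OF d D] orientation_antisym[OF d D]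
        by (metis antisymD irrefl_def)
    qed
  qed
  ultimately show False using d by (auto simp: valued_tree_def)
qed

lemma ex_sink_enumeration:
  assumes d: "valued_tree d" and D: "orientation d D"
  shows "\<exists>vs. sink_enumeration D vs"
proof -
  have "\<exists>vs. distinct vs \<and> set vs = A \<and>
      (\<forall>a v b w. vs = a @ v # b \<longrightarrow> (v, w) \<in> D \<longrightarrow> w \<in> set a \<union> (UNIV - A))" for A
  proof (induction "card A" arbitrary: A)
    case 0
    then show ?case by simp
  next
    case (Suc n)
    have D': "orientation d (converse D)"
    proof -
      have "adj d v w \<longleftrightarrow> adj d w v" for v w using d by (simp add: valued_tree_def adj_def)
      then show ?thesis using D unfolding orientation_def by blast
    qed
    have "A \<noteq> {}" using Suc by auto
    then obtain x where x: "x \<in> A" "\<forall>w\<in>A. (w, x) \<notin> D"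
      using ex_sink[OF d D'] by auto
    have "n = card (A - {x})" using Suc x by simp
    then obtain vs where vs: "distinct vs" "set vs = A - {x}"
      "\<forall>a v b w. vs = a @ v # b \<longrightarrow> (v, w) \<in> D \<longrightarrow> w \<in> set a \<union> (UNIV - (A - {x}))"
      using Suc.hyps(1) by blast
    have "\<forall>a v b w. vs @ [x] = a @ v # b \<longrightarrow> (v, w) \<in> D \<longrightarrow> w \<in> set a \<union> (UNIV - A)"
    proof (intro allI impI)
      fix a v b w assume *: "vs @ [x] = a @ v # b" "(v, w) \<in> D"
      show "w \<in> set a \<union> (UNIV - A)"
      proof (cases b rule: rev_cases)
        case Nil
        then have "vs = a" "v = x" using * by auto
        moreover have "w \<noteq> x" using * \<open>v = x\<close> orientation_irrefl[OF d D] by (auto simp: irrefl_def)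
        ultimately show ?thesis using vs by auto
      next
        case (snoc b' y)
        then have e: "vs = a @ v # b'" using * by auto
        then have "v \<in> A" using vs by auto
        then have "w \<noteq> x" using x * by auto
        then show ?thesis using vs(3) e * by blast
      qed
    qed
    then show ?case using vs x by (intro exI[of _ "vs @ [x]"]) auto
  qed
  from this[of UNIV] show ?thesis
    using sink_enumeration_iff[OF orientation_irrefl[OF d D] orientation_antisym[OF d D]]
    by auto
qed

lemma refl_word_unique:
  fixes d :: "'v::finite \<Rightarrow> 'v \<Rightarrow> nat"
  assumes d: "valued_tree d" and D: "orientation d D"
    and "distinct us" "distinct vs" "set us = set vs"
    and "\<forall>a v b w. us = a @ v # b \<longrightarrow> (v, w) \<in> D \<longrightarrow> w \<in> set us \<longrightarrow> w \<in> set a"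
    and "\<forall>a v b w. vs = a @ v # b \<longrightarrow> (v, w) \<in> D \<longrightarrow> w \<in> set vs \<longrightarrow> w \<in> set a"
  shows "(refl_word d (rev us) :: 'a::comm_ring_1 ^ 'v \<Rightarrow> 'a ^ 'v) = refl_word d (rev vs)"
  using assms(3-)
proof (induction us arbitrary: vs)
  case (Cons x us)
  have "x \<in> set vs" using Cons.prems by auto
  then obtain a b where vs: "vs = a @ x # b" by (meson split_list)
  have xout: "(x, w) \<notin> D" if "w \<in> set vs" for w
    using Cons.prems(4)[rule_format, of "[]" x us w] that Cons.prems(3) by auto
  have comm: "d x w = 0 \<and> d w x = 0" if w: "w \<in> set a" for w
  proof (rule ccontr)
    assume "\<not> ?thesis"
    then have "adj d x w" using d by (auto simp: adj_def valued_tree_def)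
    moreover have "(x, w) \<notin> D" using w vs xout by auto
    ultimately have wx: "(w, x) \<in> D" using D by (auto simp: orientation_def)
    obtain a1 a2 where a: "a = a1 @ w # a2" using w by (meson split_list)
    have "vs = a1 @ w # (a2 @ x # b)" using a vs by simp
    then have "x \<in> set a1" using Cons.prems(5) wx \<open>x \<in> set vs\<close> by blast
    then show False using Cons.prems(2) vs a by auto
  qed
  have swap: "refl_word d (rev a) \<circ> simple_refl d x = simple_refl d x \<circ> (refl_word d (rev a)
      :: 'a ^ 'v \<Rightarrow> 'a ^ 'v)"
    using comm
  proof (induction a)
    case (Cons y a)
    have y: "(simple_refl d y :: 'a ^ 'v \<Rightarrow> _) \<circ> simple_refl d x = simple_refl d x \<circ> simple_refl d y"
      using Cons.prems by (auto simp: fun_eq_iff intro!: simple_refl_commute)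
    have IH: "refl_word d (rev a) \<circ> simple_refl d x = simple_refl d x \<circ> (refl_word d (rev a)
      :: 'a ^ 'v \<Rightarrow> 'a ^ 'v)" by (rule Cons.IH) (use Cons.prems in auto)
    have "refl_word d (rev a) \<circ> (simple_refl d y \<circ> simple_refl d x)
        = simple_refl d x \<circ> (refl_word d (rev a) \<circ> (simple_refl d y :: 'a ^ 'v \<Rightarrow> 'a ^ 'v))"
      unfolding y comp_assoc[symmetric] IH ..
    then show ?case
      by (simp add: refl_word_append refl_word_Cons refl_word_Nil fun_eq_iff)
  qed (simp add: refl_word_Nil)
  have "refl_word d (rev us) = (refl_word d (rev (a @ b)) :: 'a ^ 'v \<Rightarrow> _)"
  proof (rule Cons.IH)
    show "distinct us" "distinct (a @ b)" using Cons.prems vs by auto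
    show eq: "set us = set (a @ b)" using Cons.prems vs by auto
    show "\<forall>a v b w. us = a @ v # b \<longrightarrow> (v, w) \<in> D \<longrightarrow> w \<in> set us \<longrightarrow> w \<in> set a"
    proof (intro allI impI)
      fix a' v b' w assume *: "us = a' @ v # b'" "(v, w) \<in> D" "w \<in> set us"
      then have "w \<in> set (x # a')"
        using Cons.prems(4)[rule_format, of "x # a'" v b' w] by auto
      then show "w \<in> set a'" using * Cons.prems(1) by auto
    qed
    show "\<forall>a' v b' w. a @ b = a' @ v # b' \<longrightarrow> (v, w) \<in> D \<longrightarrow> w \<in> set (a @ b) \<longrightarrow> w \<in> set a'"
    proof (intro allI impI)
      fix a' v b' w assume *: "a @ b = a' @ v # b'" "(v, w) \<in> D" "w \<in> set (a @ b)"
      have wx: "w \<noteq> x" using *(3) Cons.prems(2) vs by auto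
      have wv: "w \<in> set vs" using *(3) vs by auto
      consider us where "a = a' @ v # us" | us where "a' = a @ us" "b = us @ v # b'"
        using *(1) by (auto simp: append_eq_append_conv2 append_eq_Cons_conv)
      then show "w \<in> set a'"
      proof cases
        case 1
        then have "vs = a' @ v # (us @ x # b)" using vs by simp
        then show ?thesis using Cons.prems(5) * wv by blast
      next
        case 2
        then have "vs = (a @ x # us) @ v # b'" using vs by simp
        then have "w \<in> set (a @ x # us)" using Cons.prems(5) * wv by blast
        then show ?thesis using 2 wx by auto
      qed
    qed
  qed
  then show ?case
    using swap vs by (simp add: refl_word_append refl_word_Cons refl_word_Nil fun_eq_iff)
qed (simp add: refl_word_Nil)

lemma coxeter_eq:
  assumes "valued_tree d" "orientation d D" "sink_enumeration D vs"
  shows "coxeter d D = refl_word d (rev vs)"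
  unfolding coxeter_def
proof (rule the_equality)
  show "\<exists>ws. sink_enumeration D ws \<and> refl_word d (rev vs) = refl_word d (rev ws)"
    using assms(3) by blast
next
  fix C assume "\<exists>ws. sink_enumeration D ws \<and> C = refl_word d (rev ws)"
  then obtain ws where ws: "sink_enumeration D ws" "C = refl_word d (rev ws)" by blast
  note iff = sink_enumeration_iff[OF orientation_irrefl[OF assms(1,2)]
      orientation_antisym[OF assms(1,2)]]
  show "C = refl_word d (rev vs)"
    unfolding ws(2)
    by (rule refl_word_unique[OF assms(1,2)]) (use ws(1) assms(3) in \<open>auto simp: iff\<close>)
qed

end

theory Submission
  imports Defs
begin

text \<open>
  Whenever \<open>c = P S\<close> and \<open>c' = S P\<close>, both \<open>P\<close> and \<open>S\<inverse>\<close> conjugate \<open>c\<close> into \<open>c'\<close>, and they differ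
  only by \<open>c\<close> itself: \<open>S\<inverse> = c\<inverse> P\<close>. Along a chain \<open>C\<^sub>0, C\<^sub>1, \<dots>, C\<^sub>k\<close> of such elements one may therefore
  choose a factor \<open>P\<^sub>i\<close> or \<open>S\<^sub>i\<inverse>\<close> independently for each \<open>i\<close>. In the product of the chosen factors each
  \<open>S\<^sub>i\<inverse>\<close> can be replaced by \<open>C\<^sub>i\<^sub>-\<^sub>1\<inverse> P\<^sub>i\<close>, and \<open>C\<^sub>i\<^sub>-\<^sub>1\<inverse>\<close> becomes \<open>C\<^sub>0\<inverse>\<close> when it is moved to
  the front of \<open>P\<^sub>1 \<cdots> P\<^sub>i\<^sub>-\<^sub>1\<close>. Hence the product is
  \<open>C\<^sub>0\<close> to the power \<open>-r\<close>, times \<open>P\<^sub>1 \<cdots> P\<^sub>k\<close>, where \<open>r\<close> counts the factors \<open>S\<^sub>i\<inverse>\<close>; the places where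
  they stand do not matter (lemma \<open>mixed_product_eq\<close>).

  For \<open>T\<^sub>j\<close> the number \<open>r\<close> is \<open>j - 1\<close>, which gives the conjugation formula and the value of
  \<open>T\<^sub>p T\<^sub>q\<inverse>\<close>. For a given vertex \<open>v\<close>, choose for each \<open>i\<close> a factor whose word does not contain \<open>v\<close>.
  The resulting product avoids \<open>v\<close>, and it equals the \<open>T\<^sub>j\<close> with the same number of inverted
  factors, although the word that defines this \<open>T\<^sub>j\<close> may well contain \<open>v\<close>.
\<close>

section \<open>Products of factors of successive conjugations\<close>

definition mixed_factor ::
    "('g, 'm) monoid_scheme \<Rightarrow> (nat \<Rightarrow> 'g) \<Rightarrow> (nat \<Rightarrow> 'g) \<Rightarrow> nat set \<Rightarrow> nat \<Rightarrow> 'g" where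
  "mixed_factor G P S I i = (if i \<in> I then inv\<^bsub>G\<^esub> (S i) else P i)"

definition mixed_product ::
    "('g, 'm) monoid_scheme \<Rightarrow> (nat \<Rightarrow> 'g) \<Rightarrow> (nat \<Rightarrow> 'g) \<Rightarrow> nat set \<Rightarrow> nat \<Rightarrow> 'g" where
  "mixed_product G P S I n = list_mult G (map (mixed_factor G P S I) [1..<n + 1])"

lemma list_mult_closed:
  assumes "monoid G" "set xs \<subseteq> carrier G"
  shows "list_mult G xs \<in> carrier G"
proof -
  interpret monoid G by fact
  show ?thesis using assms(2) by (induction xs) (auto simp: list_mult_def)
qed

lemma list_mult_snoc:
  assumes "monoid G" "set xs \<subseteq> carrier G" "x \<in> carrier G"
  shows "list_mult G (xs @ [x]) = list_mult G xs \<otimes>\<^bsub>G\<^esub> x"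
proof -
  interpret monoid G by fact
  show ?thesis using assms(2)
  proof (induction xs)
    case (Cons y ys)
    then show ?case
      using list_mult_closed[OF assms(1), of ys] assms(3)
      by (simp add: list_mult_def m_assoc)
  qed (use assms(3) in \<open>simp add: list_mult_def\<close>)
qed

lemma mixed_product_0: "mixed_product G P S I 0 = \<one>\<^bsub>G\<^esub>"
  by (simp add: mixed_product_def list_mult_def)

lemma conjugator_eq_mixed_product:
  assumes "j \<in> {1..k + 1}"
  shows "conjugator G k P S j = mixed_product G P S {k + 2 - j..k} k"
proof -
  have "1 \<le> k + 2 - j" using assms by auto
  then have "[1..<k + 1] = [1..<k + 2 - j] @ [k + 2 - j..<k + 1]"
    using upt_add_eq_append[of 1 "k + 2 - j" "j - 1"] assms by (simp del: upt_Suc)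
  then have "map (mixed_factor G P S {k + 2 - j..k}) [1..<k + 1]
      = map P [1..<k + 2 - j] @ map (\<lambda>i. inv\<^bsub>G\<^esub> (S i)) [k + 2 - j..<k + 1]"
    by (auto simp: mixed_factor_def)
  then show ?thesis by (simp add: conjugator_def mixed_product_def)
qed

locale swap_chain = group G for G (structure) +
  fixes k :: nat and C P S :: "nat \<Rightarrow> 'a"
  assumes C_closed: "i \<le> k \<Longrightarrow> C i \<in> carrier G"
    and P_closed: "i \<in> {1..k} \<Longrightarrow> P i \<in> carrier G"
    and S_closed: "i \<in> {1..k} \<Longrightarrow> S i \<in> carrier G"
    and C_before: "i \<in> {1..k} \<Longrightarrow> C (i - 1) = P i \<otimes> S i"
    and C_after: "i \<in> {1..k} \<Longrightarrow> C i = S i \<otimes> P i"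
begin

lemma C0_closed: "C 0 \<in> carrier G"
  by (simp add: C_closed)

lemma mixed_factor_closed: "i \<in> {1..k} \<Longrightarrow> mixed_factor G P S I i \<in> carrier G"
  by (simp add: mixed_factor_def P_closed S_closed)

lemma mixed_product_closed:
  assumes "n \<le> k"
  shows "mixed_product G P S I n \<in> carrier G"
  unfolding mixed_product_def
  by (rule list_mult_closed) (use assms mixed_factor_closed in \<open>auto intro: monoid_axioms\<close>)

lemma mixed_product_Suc:
  assumes "Suc n \<le> k"
  shows "mixed_product G P S I (Suc n) = mixed_product G P S I n \<otimes> mixed_factor G P S I (Suc n)"
proof -
  have "set (map (mixed_factor G P S I) [1..<n + 1]) \<subseteq> carrier G"
    using assms by (auto intro!: mixed_factor_closed)
  from list_mult_snoc[OF monoid_axioms this mixed_factor_closed, of "Suc n"] show ?thesis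
    using assms by (simp add: mixed_product_def)
qed

lemma C0_mixed_product:
  assumes "n \<le> k"
  shows "C 0 \<otimes> mixed_product G P S {} n = mixed_product G P S {} n \<otimes> C n"
  using assms
proof (induction n)
  case 0
  then show ?case by (simp add: mixed_product_0 C0_closed)
next
  case (Suc n)
  let ?Q = "mixed_product G P S {} n"
  have cl: "?Q \<in> carrier G" "P (Suc n) \<in> carrier G" "S (Suc n) \<in> carrier G" "C n \<in> carrier G"
    using Suc.prems by (simp_all add: mixed_product_closed P_closed S_closed C_closed)
  have "C 0 \<otimes> (?Q \<otimes> P (Suc n)) = ?Q \<otimes> C n \<otimes> P (Suc n)"
    using Suc cl by (simp add: C0_closed m_assoc[symmetric])
  also have "\<dots> = ?Q \<otimes> P (Suc n) \<otimes> C (Suc n)"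
    using Suc.prems cl C_before[of "Suc n"] C_after[of "Suc n"] by (simp add: m_assoc)
  finally show ?case
    using Suc.prems by (simp add: mixed_product_Suc mixed_factor_def)
qed

text \<open>
  An inverted factor at place \<open>n + 1\<close> contributes \<open>S\<inverse> = C\<^sub>n\<inverse> P\<close>, and moving \<open>C\<^sub>n\<inverse>\<close> to the left past
  \<open>P\<^sub>1 \<cdots> P\<^sub>n\<close> turns it into \<open>C\<^sub>0\<inverse>\<close>. So each inverted factor costs one \<open>C\<^sub>0\<inverse>\<close>, wherever it stands.
\<close>

lemma mixed_product_eq:
  assumes "n \<le> k"
  shows "mixed_product G P S I n =
    C 0 [^] (- int (card (I \<inter> {1..n}))) \<otimes> mixed_product G P S {} n"
  using assms
proof (induction n)
  case 0
  then show ?case by (simp add: mixed_product_0)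
next
  case (Suc n)
  let ?Q = "mixed_product G P S {} n"
  let ?c = "int (card (I \<inter> {1..n}))"
  have cl: "?Q \<in> carrier G" "P (Suc n) \<in> carrier G" "S (Suc n) \<in> carrier G" "C n \<in> carrier G"
    using Suc.prems by (simp_all add: mixed_product_closed P_closed S_closed C_closed)
  have pow: "C 0 [^] z \<in> carrier G" for z :: int
    by (simp add: C0_closed int_pow_closed)
  have Suc_Q: "mixed_product G P S {} (Suc n) = ?Q \<otimes> P (Suc n)"
    using Suc.prems by (simp add: mixed_product_Suc mixed_factor_def)
  have IH: "mixed_product G P S I (Suc n) =
      C 0 [^] (- ?c) \<otimes> (?Q \<otimes> mixed_factor G P S I (Suc n))"
    using Suc cl pow mixed_factor_closed[of "Suc n" I]
    by (simp add: mixed_product_Suc m_assoc)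
  show ?case
  proof (cases "Suc n \<in> I")
    case False
    then have "I \<inter> {1..Suc n} = I \<inter> {1..n}" by (auto simp: le_Suc_eq)
    then show ?thesis using IH False Suc_Q by (simp add: mixed_factor_def)
  next
    case True
    then have "I \<inter> {1..Suc n} = insert (Suc n) (I \<inter> {1..n})" by (auto simp: le_Suc_eq)
    then have card: "- int (card (I \<inter> {1..Suc n})) = - ?c + - 1" by simp
    have "C 0 \<otimes> (?Q \<otimes> inv (S (Suc n))) = ?Q \<otimes> C n \<otimes> inv (S (Suc n))"
      using C0_mixed_product[of n] Suc.prems cl by (simp add: C0_closed m_assoc[symmetric])
    also have "\<dots> = ?Q \<otimes> P (Suc n)"
      using C_before[of "Suc n"] Suc.prems cl by (simp add: m_assoc)
    finally have "?Q \<otimes> inv (S (Suc n)) = inv (C 0) \<otimes> (?Q \<otimes> P (Suc n))"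
      using cl C0_closed by (metis inv_closed inv_solve_left m_closed)
    moreover have "C 0 [^] (- ?c + - 1) = C 0 [^] (- ?c) \<otimes> inv (C 0)"
      using int_pow_mult[OF C0_closed, of "- ?c" "- 1"]
      by (simp add: C0_closed int_pow_neg)
    ultimately show ?thesis
      unfolding card using IH True Suc_Q cl pow
      by (simp add: mixed_factor_def m_assoc C0_closed)
  qed
qed

lemma mixed_product_cong_card:
  assumes "card (I \<inter> {1..k}) = card (J \<inter> {1..k})"
  shows "mixed_product G P S I k = mixed_product G P S J k"
  using mixed_product_eq[of k I] mixed_product_eq[of k J] assms by simp

lemma conjugator_eq:
  assumes "j \<in> {1..k + 1}"
  shows "conjugator G k P S j = C 0 [^] (1 - int j) \<otimes> mixed_product G P S {} k"
proof -
  have "{k + 2 - j..k} \<inter> {1..k} = {k + 2 - j..k}" using assms by auto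
  then have "int (card ({k + 2 - j..k} \<inter> {1..k})) = int j - 1"
    using assms by (simp add: of_nat_diff del: Int_atLeastAtMost)
  then show ?thesis
    using conjugator_eq_mixed_product[OF assms, of G P S] mixed_product_eq[of k "{k + 2 - j..k}"]
    by simp
qed

lemma conjugator_conjugates:
  assumes "j \<in> {1..k + 1}"
  shows "inv (conjugator G k P S j) \<otimes> C 0 \<otimes> conjugator G k P S j = C k"
proof -
  let ?Q = "mixed_product G P S {} k"
  let ?z = "C 0 [^] (1 - int j)"
  have cl: "?Q \<in> carrier G" "?z \<in> carrier G" "C 0 \<in> carrier G" "C k \<in> carrier G"
    by (simp_all add: mixed_product_closed int_pow_closed C_closed)
  have comm: "C 0 \<otimes> ?z = ?z \<otimes> C 0"
    using int_pow_mult[OF C0_closed, of 1 "1 - int j"]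
      int_pow_mult[OF C0_closed, of "1 - int j" 1]
    by (simp add: C0_closed add.commute)
  have "C 0 \<otimes> (?z \<otimes> ?Q) = ?z \<otimes> (C 0 \<otimes> ?Q)"
    using cl comm by (simp add: m_assoc[symmetric])
  also have "\<dots> = (?z \<otimes> ?Q) \<otimes> C k"
    using cl C0_mixed_product[of k] by (simp add: m_assoc)
  finally have "C 0 \<otimes> (?z \<otimes> ?Q) = (?z \<otimes> ?Q) \<otimes> C k" .
  then show ?thesis
    using cl by (simp add: conjugator_eq[OF assms] m_assoc inv_solve_left')
qed

lemma conjugator_quotient:
  assumes "m \<in> {1..k + 1}" "n \<in> {1..k + 1}"
  shows "conjugator G k P S m \<otimes> inv (conjugator G k P S n) = C 0 [^] (int n - int m)"
proof -
  let ?Q = "mixed_product G P S {} k"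
  let ?x = "C 0 [^] (1 - int m)" and ?y = "C 0 [^] (1 - int n)"
  have cl: "?Q \<in> carrier G" "?x \<in> carrier G" "?y \<in> carrier G"
    by (simp_all add: mixed_product_closed int_pow_closed C0_closed)
  have "(?x \<otimes> ?Q) \<otimes> inv (?y \<otimes> ?Q) = ?x \<otimes> (?Q \<otimes> inv ?Q) \<otimes> inv ?y"
    using cl by (simp only: inv_mult_group m_assoc m_closed inv_closed)
  also have "\<dots> = ?x \<otimes> inv ?y"
    using cl by simp
  also have "\<dots> = C 0 [^] (int n - int m)"
    using int_pow_diff[OF C0_closed, of "1 - int m" "1 - int n"] by simp
  finally show ?thesis
    using assms by (simp add: conjugator_eq)
qed

text \<open>
  By the preceding count, inverting any \<open>r\<close> of the factors gives the same element as inverting the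
  last \<open>r\<close>, which is what \<open>T\<close> with index \<open>r + 1\<close> does.
\<close>

lemma mixed_product_is_conjugator:
  "\<exists>j\<in>{1..k + 1}. conjugator G k P S j = mixed_product G P S I k"
proof
  let ?j = "card (I \<inter> {1..k}) + 1"
  have "card (I \<inter> {1..k}) \<le> card {1..k}" by (intro card_mono) auto
  then show j: "?j \<in> {1..k + 1}" by simp
  have "{k + 2 - ?j..k} \<inter> {1..k} = {k + 2 - ?j..k}" using j by auto
  then have "card ({k + 2 - ?j..k} \<inter> {1..k}) = card (I \<inter> {1..k})"
    using j by (simp del: Int_atLeastAtMost)
  then show "conjugator G k P S ?j = mixed_product G P S I k"
    unfolding conjugator_eq_mixed_product[OF j] by (rule mixed_product_cong_card)
qed

end

section \<open>Words in the simple reflections\<close>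

lemma inv_refl_word:
  fixes d :: "'v::finite \<Rightarrow> 'v \<Rightarrow> nat"
  defines "W \<equiv> (weyl_group d :: ('a::comm_ring_1 ^ 'v \<Rightarrow> 'a ^ 'v) monoid)"
  shows "inv\<^bsub>W\<^esub> (refl_word d vs) = refl_word d (rev vs)"
proof -
  interpret group W unfolding W_def by (rule group_weyl_group)
  have "refl_word d (rev vs) \<circ> refl_word d vs = (id :: 'a ^ 'v \<Rightarrow> 'a ^ 'v)"
  proof (induction vs)
    case (Cons v vs)
    then show ?case
      by (simp add: refl_word_append refl_word_Cons refl_word_Nil fun_eq_iff)
  qed (simp add: refl_word_Nil)
  moreover have "\<one>\<^bsub>W\<^esub> = refl_word d []"
    by (simp add: W_def refl_word_def list_mult_def)
  ultimately show ?thesis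
    by (intro inv_equality)
      (simp_all add: W_def weyl_group_mult refl_word_weyl_group refl_word_Nil)
qed

lemma list_mult_refl_words_avoid:
  assumes "\<forall>x\<in>set xs. \<exists>vs. x = refl_word d vs \<and> v \<notin> set vs"
  shows "\<exists>vs. list_mult (weyl_group d) xs = refl_word d vs \<and> v \<notin> set vs"
  using assms
proof (induction xs)
  case Nil
  show ?case by (intro exI[of _ "[]"]) (simp add: refl_word_def list_mult_def)
next
  case (Cons x xs)
  then obtain us vs where "x = refl_word d us" "v \<notin> set us"
    "list_mult (weyl_group d) xs = refl_word d vs" "v \<notin> set vs"
    by auto
  then show ?case
    by (intro exI[of _ "us @ vs"])
      (simp add: list_mult_def weyl_group_mult refl_word_weyl_group refl_word_append)
qed

lemma coxeter_weyl_group: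
  assumes "valued_tree d" "orientation d D"
  shows "coxeter d D \<in> carrier (weyl_group d)"
  using ex_sink_enumeration[OF assms] coxeter_eq[OF assms] refl_word_weyl_group by metis

theorem theorem6p11:
  fixes d :: "'v::finite \<Rightarrow> 'v \<Rightarrow> nat"
    and D' D'' :: "('v \<times> 'v) set"
    and D :: "nat \<Rightarrow> ('v \<times> 'v) set"
    and k :: nat
    and P S :: "nat \<Rightarrow> ('a::{comm_ring_1, ring_char_0} ^ 'v \<Rightarrow> 'a ^ 'v)"
    and p s :: "nat \<Rightarrow> 'v list"
  defines "W \<equiv> (weyl_group d :: ('a ^ 'v \<Rightarrow> 'a ^ 'v) monoid)"
    and "T \<equiv> conjugator (weyl_group d) k P S"
  assumes tree: "valued_tree d"
    and ends: "orientation d D'" "orientation d D''"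
    and diff: "card (reversed_edges D' D'') = k"
    and chain_ends: "D 0 = D'" "D k = D''"
    and chain: "\<forall>i\<le>k. orientation d (D i)"
    and step: "\<forall>i\<in>{1..k}. card (reversed_edges (D (i - 1)) (D i)) = 1"
    and decomp: "\<forall>i\<in>{1..k}. P i = refl_word d (p i) \<and> S i = refl_word d (s i)"
    and PS: "\<forall>i\<in>{1..k}. coxeter d (D (i - 1)) = P i \<otimes>\<^bsub>W\<^esub> S i"
    and SP: "\<forall>i\<in>{1..k}. coxeter d (D i) = S i \<otimes>\<^bsub>W\<^esub> P i"
    and missing: "\<forall>v. \<forall>i\<in>{1..k}. v \<notin> set (p i) \<or> v \<notin> set (rev (s i))"
  shows "((\<forall>j\<in>{1..k + 1}. inv\<^bsub>W\<^esub> (T j) \<otimes>\<^bsub>W\<^esub> coxeter d D' \<otimes>\<^bsub>W\<^esub> T j = coxeter d D'') \<and>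
          (\<forall>v. \<exists>j\<in>{1..k + 1}. \<exists>vs. T j = refl_word d vs \<and> v \<notin> set vs)) \<and>
         (\<forall>m\<in>{1..k + 1}. \<forall>n\<in>{1..k + 1}.
            T m \<otimes>\<^bsub>W\<^esub> inv\<^bsub>W\<^esub> (T n) = coxeter d D' [^]\<^bsub>W\<^esub> (int n - int m))"
proof -
  interpret swap_chain W k "\<lambda>i. coxeter d (D i)" P S
    unfolding swap_chain_def swap_chain_axioms_def
    using chain decomp PS SP
    by (auto simp: W_def group_weyl_group refl_word_weyl_group coxeter_weyl_group[OF tree])
  have T: "T = conjugator W k P S" by (simp add: T_def W_def)
  have "\<exists>j\<in>{1..k + 1}. \<exists>vs. T j = refl_word d vs \<and> v \<notin> set vs" for v
  proof -
    \<comment> \<open>Invert exactly where \<open>p i\<close> contains \<open>v\<close>: then \<open>s i\<close>, hence the word of \<open>S\<^sub>i\<inverse>\<close>, avoids it.\<close>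
    let ?I = "{i. v \<in> set (p i)}"
    have "\<exists>vs. mixed_factor W P S ?I i = refl_word d vs \<and> v \<notin> set vs" if i: "i \<in> {1..k}" for i
    proof (cases "v \<in> set (p i)")
      case True
      then have "v \<notin> set (rev (s i))" using missing i by blast
      then show ?thesis
        using True decomp i by (auto simp: mixed_factor_def W_def inv_refl_word)
    qed (use decomp i in \<open>auto simp: mixed_factor_def\<close>)
    then have "\<exists>vs. mixed_product W P S ?I k = refl_word d vs \<and> v \<notin> set vs"
      unfolding mixed_product_def W_def by (intro list_mult_refl_words_avoid) auto
    then show ?thesis
      using mixed_product_is_conjugator[of ?I] unfolding T by metis
  qed
  then show ?thesis
    using conjugator_conjugates conjugator_quotient chain_ends unfolding T by auto
qed

end
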